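(* Let $Q:[0,1]\to\mathbb{R}$ be a function with a continuous second derivative on $[0,1]$, and let $\theta = \int_0^1 Q(x)\,dx$. For each $n\ge 1$, let $Y_1\le Y_2\le\dots\le Y_n$ be the ordered sample associated with $n$ independent uniform observations on $[0,1]$, set $Y_0 = 0$ and $Y_{n+1} = 1$, and define the estimator $$\theta_n = \frac{1}{2}\left[\sum_{i=0}^{n}\bigl(Q(Y_i)+Q(Y_{i+1})\bigr)\bigl(Y_{i+1}-Y_i\bigr)\right].$$ Then there exists a constant $M$ (not depending on $n$) such that $$E\left[(\theta_n-\theta)^2\right]\le \frac{M}{n^4}\qquad\text{for all } n\ge 1.$$
   Context: The ordered sample $Y_1\le\dots\le Y_n$ means the order statistics of $n$ independent random variables uniformly distributed on $[0,1]$. The expectation $E$ is with respect to the joint distribution of these uniform random variables. *)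

theory Defs
  imports "HOL-Probability.Probability"
begin

text \<open>
  The observations are required to lie in \<open>[0,1]\<close> at every point of the probability space, not
  just almost surely: the estimator below is only meaningful there, since the values of \<open>Q\<close>
  outside \<open>[0,1]\<close> are arbitrary.
\<close>

definition uniform_sample :: "'a measure \<Rightarrow> nat \<Rightarrow> (nat \<Rightarrow> 'a \<Rightarrow> real) \<Rightarrow> bool" where
  "uniform_sample M n X \<longleftrightarrow>
     prob_space M \<and>
     prob_space.indep_vars M (\<lambda>_. borel) X {1..n} \<and>
     (\<forall>i\<in>{1..n}. distr M lborel (X i) = uniform_measure lborel {0..1}) \<and>
     (\<forall>i\<in>{1..n}. \<forall>\<omega>\<in>space M. X i \<omega> \<in> {0..1})"

text \<open>
  Values \<open>x 1, \<dots>, x n\<close> in increasing order (with repetitions), indexed by \<open>1, \<dots>, n\<close> and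
  extended by \<open>0\<close> at index \<open>0\<close> and by \<open>1\<close> at index \<open>n + 1\<close>.
\<close>

definition ordered_sample :: "nat \<Rightarrow> (nat \<Rightarrow> real) \<Rightarrow> nat \<Rightarrow> real" where
  "ordered_sample n x i =
     (if i = 0 then 0
      else if i = n + 1 then 1
      else sort (map x [1..<n + 1]) ! (i - 1))"

definition trapezoid_estimator :: "(real \<Rightarrow> real) \<Rightarrow> nat \<Rightarrow> (nat \<Rightarrow> real) \<Rightarrow> real" where
  "trapezoid_estimator Q n x =
     (let Y = ordered_sample n x in
      1 / 2 * (\<Sum>i=0..n. (Q (Y i) + Q (Y (i + 1))) * (Y (i + 1) - Y i)))"

end

theory Submission
  imports Defs
begin

text \<open>
  The trapezoid rule on an interval of length \<open>d\<close> has error at most \<open>K d\<^sup>3 / 2\<close>, where \<open>K\<close> bounds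
  \<open>\<bar>Q''\<bar>\<close>. The spacings \<open>d\<^sub>i\<close> sum to \<open>1\<close>, so convexity gives \<open>(\<Sum> d\<^sub>i\<^sup>3)\<^sup>2 \<le> \<Sum> d\<^sub>i\<^sup>5\<close>. Finally \<open>d\<^sup>5\<close> is the
  integral of \<open>20 (t - s)\<^sup>3\<close> over the pairs \<open>s < t\<close> in an interval of length \<open>d\<close>, so \<open>\<Sum> d\<^sub>i\<^sup>5\<close> is
  the integral of \<open>20 (t - s)\<^sup>3\<close> over the pairs \<open>s < t\<close> not separated by an observation. A given
  pair is not separated with probability \<open>(1 - (t - s))\<^sup>n \<le> exp (- n (t - s))\<close>, and Tonelli's theorem
  bounds the expectation by \<open>20 * 6 / n\<^sup>4\<close>.
\<close>

subsection \<open>The trapezoid rule\<close>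

text \<open>As a function \<open>h\<close> of the right end, the error vanishes at \<open>a\<close>,
  and so does its derivative \<open>g\<close>, whose own derivative is
  \<open>Q'' x * (x - a) / 2\<close>. Two mean value inequalities then yield the cubic bound. Each
  takes the largest derivative over the interval, so the sharp constant K/12 is lost; only the order
  in \<open>b - a\<close> matters here.\<close>

lemma trapezoid_rule_error:
  fixes F Q Q' Q'' :: "real \<Rightarrow> real"
  assumes ab: "0 \<le> a" "a \<le> b" "b \<le> 1"
    and F: "\<And>x. x \<in> {0..1} \<Longrightarrow> (F has_real_derivative Q x) (at x within {0..1})"
    and Q: "\<And>x. x \<in> {0..1} \<Longrightarrow> (Q has_real_derivative Q' x) (at x within {0..1})"
    and Q': "\<And>x. x \<in> {0..1} \<Longrightarrow> (Q' has_real_derivative Q'' x) (at x within {0..1})"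
    and K: "\<And>x. x \<in> {0..1} \<Longrightarrow> \<bar>Q'' x\<bar> \<le> K"
  shows "\<bar>1 / 2 * ((Q a + Q b) * (b - a)) - (F b - F a)\<bar> \<le> K / 2 * (b - a) ^ 3"
proof -
  have sub: "{a..b} \<subseteq> {0..1}" using ab by auto
  define g where "g x = Q' x * (x - a) / 2 - (Q x - Q a) / 2" for x
  define h where "h x = 1 / 2 * ((Q a + Q x) * (x - a)) - (F x - F a)" for x
  have g: "(g has_real_derivative Q'' x * (x - a) / 2) (at x within {a..b})" if "x \<in> {a..b}" for x
    unfolding g_def using that sub
    by (auto intro!: derivative_eq_intros DERIV_subset[OF Q sub] DERIV_subset[OF Q' sub]
        simp: field_simps)
  have h: "(h has_real_derivative g x) (at x within {a..b})" if "x \<in> {a..b}" for x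
    unfolding h_def g_def using that sub
    by (auto intro!: derivative_eq_intros DERIV_subset[OF Q sub] DERIV_subset[OF F sub]
        simp: field_simps)
  have K0: "K \<ge> 0" using K[of 0] by auto
  have gb: "\<bar>g x\<bar> \<le> K / 2 * (x - a)\<^sup>2" if x: "x \<in> {a..b}" for x
  proof -
    have "norm (g x - g a) \<le> K / 2 * (x - a) * norm (x - a)"
    proof (rule field_differentiable_bound[where S = "{a..x}"])
      fix z assume z: "z \<in> {a..x}"
      show "(g has_field_derivative Q'' z * (z - a) / 2) (at z within {a..x})"
        by (rule DERIV_subset[OF g]) (use z x in auto)
      have "\<bar>Q'' z\<bar> * (z - a) \<le> K * (x - a)"
        by (rule mult_mono) (use z x sub K[of z] K0 in auto)
      then show "norm (Q'' z * (z - a) / 2) \<le> K / 2 * (x - a)"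
        using z by (simp add: abs_mult)
    qed (use x in auto)
    then show ?thesis using x by (simp add: g_def power2_eq_square mult.assoc)
  qed
  have "norm (h b - h a) \<le> K / 2 * (b - a)\<^sup>2 * norm (b - a)"
  proof (rule field_differentiable_bound[where S = "{a..b}"])
    fix z assume z: "z \<in> {a..b}"
    show "(h has_field_derivative g z) (at z within {a..b})" by (rule h[OF z])
    have "K / 2 * (z - a)\<^sup>2 \<le> K / 2 * (b - a)\<^sup>2"
      by (rule mult_left_mono[OF power_mono]) (use z K0 in auto)
    then show "norm (g z) \<le> K / 2 * (b - a)\<^sup>2" using gb[OF z] by simp
  qed (use ab in auto)
  then show ?thesis
    using ab by (simp add: h_def power2_eq_square power3_eq_cube mult.assoc)
qed

text \<open>Read the \<open>d i\<close> as probability weights. Then \<open>m\<close> is the mean of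
  \<open>(d i)\<^sup>2\<close>, and the claim says that the variance of \<open>(d i)\<^sup>2\<close>
  is nonnegative.\<close>

lemma sum_cubes_squared_le_sum_fifth_powers:
  fixes d :: "'b \<Rightarrow> real"
  assumes "\<And>i. i \<in> I \<Longrightarrow> 0 \<le> d i" "sum d I = 1"
  shows "(\<Sum>i\<in>I. d i ^ 3)\<^sup>2 \<le> (\<Sum>i\<in>I. d i ^ 5)"
proof -
  define m where "m = (\<Sum>i\<in>I. d i ^ 3)"
  have "0 \<le> (\<Sum>i\<in>I. d i * ((d i)\<^sup>2 - m)\<^sup>2)"
    by (intro sum_nonneg mult_nonneg_nonneg assms) auto
  also have "\<dots> = (\<Sum>i\<in>I. d i ^ 5 - 2 * m * d i ^ 3 + m\<^sup>2 * d i)"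
    by (intro sum.cong refl) (simp add: power2_eq_square eval_nat_numeral algebra_simps)
  also have "\<dots> = (\<Sum>i\<in>I. d i ^ 5) - 2 * m * m + m\<^sup>2"
    by (simp add: sum.distrib sum_subtractf sum_distrib_left[symmetric] assms(2) m_def[symmetric])
  finally show ?thesis by (simp add: m_def[symmetric] power2_eq_square)
qed

subsection \<open>Order statistics\<close>

lemma sorted_nth_le_iff:
  assumes "sorted xs" "k < length xs"
  shows "xs ! k \<le> c \<longleftrightarrow> k < length (filter (\<lambda>x. x \<le> c) xs)"
  using assms
proof (induction xs arbitrary: k)
  case (Cons y ys)
  show ?case
  proof (cases "y \<le> c")
    case True
    then show ?thesis using Cons by (cases k) auto
  next
    case False
    then have "filter (\<lambda>x. x \<le> c) ys = []"
      using Cons.prems by (auto simp: filter_empty_conv)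
    moreover have "y \<le> (y # ys) ! k"
      using Cons.prems nth_mem[of k "y # ys"] by auto
    ultimately show ?thesis using False by simp
  qed
qed simp

text \<open>Counting ignores order, so a statement about an order statistic becomes one about the
  unsorted values. This is how the order statistics are shown to be measurable: the count is a
  measurable integer-valued function.\<close>

lemma sort_nth_le_iff:
  assumes "k < length xs"
  shows "sort xs ! k \<le> c \<longleftrightarrow> k < length (filter (\<lambda>x. x \<le> c) xs)"
  using sorted_nth_le_iff[of "sort xs" k c] assms by (simp add: filter_sort)

lemma measurable_length_filter:
  assumes "\<And>i. i \<in> set is \<Longrightarrow> Measurable.pred M (P i)"
  shows "(\<lambda>\<omega>. length (filter (\<lambda>i. P i \<omega>) is)) \<in> measurable M (count_space UNIV)"
  using assms
proof (induction "is")
  case (Cons i "is")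
  have [measurable]: "Measurable.pred M (P i)"
    "(\<lambda>\<omega>. length (filter (\<lambda>i. P i \<omega>) is)) \<in> measurable M (count_space UNIV)"
    using Cons by auto
  have "(\<lambda>\<omega>. if P i \<omega> then Suc (length (filter (\<lambda>i. P i \<omega>) is))
          else length (filter (\<lambda>i. P i \<omega>) is)) \<in> measurable M (count_space UNIV)"
    by measurable
  then show ?case by (simp add: if_distrib[of length] cong: if_cong)
qed simp

lemma borel_measurable_sort_nth:
  fixes X :: "'i \<Rightarrow> 'a \<Rightarrow> real"
  assumes "\<And>i. i \<in> set is \<Longrightarrow> X i \<in> borel_measurable M" and k: "k < length is"
  shows "(\<lambda>\<omega>. sort (map (\<lambda>i. X i \<omega>) is) ! k) \<in> borel_measurable M"
  unfolding borel_measurable_iff_le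
proof
  fix c
  have [measurable]: "(\<lambda>\<omega>. length (filter (\<lambda>i. X i \<omega> \<le> c) is)) \<in> measurable M (count_space UNIV)"
    using assms(1) by (intro measurable_length_filter) (auto intro: borel_measurable_le)
  have "{\<omega> \<in> space M. k < length (filter (\<lambda>i. X i \<omega> \<le> c) is)} \<in> sets M"
    by measurable
  then show "{\<omega> \<in> space M. sort (map (\<lambda>i. X i \<omega>) is) ! k \<le> c} \<in> sets M"
    using k by (simp add: sort_nth_le_iff filter_map o_def)
qed

lemma ordered_sample_measurable:
  assumes "\<And>i. i \<in> {1..n} \<Longrightarrow> X i \<in> borel_measurable M" "i \<le> n + 1"
  shows "(\<lambda>\<omega>. ordered_sample n (\<lambda>i. X i \<omega>) i) \<in> borel_measurable M"
proof (cases "i = 0 \<or> i = n + 1")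
  case False
  then have "(\<lambda>\<omega>. sort (map (\<lambda>i. X i \<omega>) [1..<n + 1]) ! (i - 1)) \<in> borel_measurable M"
    using assms by (intro borel_measurable_sort_nth) auto
  then show ?thesis using False by (simp add: ordered_sample_def)
qed (auto simp: ordered_sample_def)

lemma ordered_sample_ends [simp]:
  "ordered_sample n x 0 = 0" "ordered_sample n x (Suc n) = 1"
  by (simp_all add: ordered_sample_def)

text \<open>Sorting keeps the set of values. This later shows that no observation lies strictly
  between consecutive order statistics.\<close>

lemma ordered_sample_surj:
  assumes "k \<in> {1..n}"
  obtains j where "j \<in> {1..n}" "ordered_sample n x j = x k"
proof -
  have "x k \<in> set (sort (map x [1..<n + 1]))" using assms by (auto simp del: upt_Suc)
  then obtain j where "j < length (sort (map x [1..<n + 1]))" "sort (map x [1..<n + 1]) ! j = x k"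
    unfolding in_set_conv_nth by blast
  \<comment> \<open>List positions start at 0, order statistics at 1.\<close>
  then show thesis by (intro that[of "j + 1"]) (auto simp: ordered_sample_def simp del: upt_Suc)
qed

lemma ordered_sample_bounds:
  assumes "\<And>k. k \<in> {1..n} \<Longrightarrow> x k \<in> {0..1}" "i \<le> n + 1"
  shows "ordered_sample n x i \<in> {0..1}"
proof (cases "i = 0 \<or> i = n + 1")
  case False
  then have "sort (map x [1..<n + 1]) ! (i - 1) \<in> set (sort (map x [1..<n + 1]))"
    using assms(2) by (intro nth_mem) auto
  then show ?thesis using False assms(1) by (auto simp: ordered_sample_def simp del: upt_Suc)
qed (auto simp: ordered_sample_def)

lemma ordered_sample_mono:
  assumes x: "\<And>k. k \<in> {1..n} \<Longrightarrow> x k \<in> {0..1}" and "i \<le> j" "j \<le> n + 1"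
  shows "ordered_sample n x i \<le> ordered_sample n x j"
proof -
  have bd: "ordered_sample n x i \<in> {0..1}" "ordered_sample n x j \<in> {0..1}"
    using assms(2,3) by (auto intro!: ordered_sample_bounds x simp del: atLeastAtMost_iff)
  \<comment> \<open>Sortedness only covers the genuine observations; the added ends 0 and 1 are
    compared through the range \<open>{0..1}\<close>.\<close>
  consider "i = 0" | "j = n + 1" | "0 < i" "j \<le> n" using assms by linarith
  then show ?thesis
  proof cases
    case 3
    then have "sort (map x [1..<n + 1]) ! (i - 1) \<le> sort (map x [1..<n + 1]) ! (j - 1)"
      using assms by (intro sorted_nth_mono) auto
    then show ?thesis using 3 assms by (simp add: ordered_sample_def)
  qed (use bd in auto)
qed

section \<open>Measurability and pathwise error of the estimator\<close>

lemma trapezoid_estimator_measurable: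
  assumes X: "\<And>i. i \<in> {1..n} \<Longrightarrow> X i \<in> borel_measurable M"
    and b: "\<And>i \<omega>. i \<in> {1..n} \<Longrightarrow> \<omega> \<in> space M \<Longrightarrow> X i \<omega> \<in> {0..1}"
    and Q: "continuous_on {0..1} Q"
  shows "(\<lambda>\<omega>. trapezoid_estimator Q n (\<lambda>i. X i \<omega>)) \<in> borel_measurable M"
proof -
  have Y: "(\<lambda>\<omega>. ordered_sample n (\<lambda>i. X i \<omega>) i) \<in> borel_measurable M" if "i \<le> n + 1" for i
    using ordered_sample_measurable[OF X that] .
  \<comment> \<open>\<open>Q\<close> is controlled only on \<open>{0..1}\<close>, so the composition
    goes through the restricted Borel space. This uses that the observations lie in
    \<open>{0..1}\<close> at every sample point.\<close>
  have QY: "(\<lambda>\<omega>. Q (ordered_sample n (\<lambda>i. X i \<omega>) i)) \<in> borel_measurable M" if i: "i \<le> n + 1" for i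
  proof (rule measurable_compose[where N = "restrict_space borel {0..1}" and g = Q])
    have "(\<lambda>\<omega>. ordered_sample n (\<lambda>i. X i \<omega>) i) \<in> space M \<rightarrow> {0..1}"
      by (intro funcsetI ordered_sample_bounds b i)
    then show "(\<lambda>\<omega>. ordered_sample n (\<lambda>i. X i \<omega>) i) \<in> measurable M (restrict_space borel {0..1})"
      by (rule measurable_restrict_space2[OF _ Y[OF i]])
    show "Q \<in> borel_measurable (restrict_space borel {0..1})"
      by (rule borel_measurable_continuous_on_restrict[OF Q])
  qed
  show ?thesis
    unfolding trapezoid_estimator_def Let_def
    by (intro borel_measurable_times borel_measurable_sum borel_measurable_diff
        borel_measurable_add borel_measurable_const Y QY) auto
qed

text \<open>The trapezoid bound on each spacing gives an error of at most K/2 times the sum of the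
  cubed spacings; the convexity inequality then absorbs the square.\<close>

lemma trapezoid_estimator_error:
  fixes F Q Q' Q'' :: "real \<Rightarrow> real"
  assumes x: "\<And>k. k \<in> {1..n} \<Longrightarrow> x k \<in> {0..1}"
    and F: "\<And>x. x \<in> {0..1} \<Longrightarrow> (F has_real_derivative Q x) (at x within {0..1})"
    and Q: "\<And>x. x \<in> {0..1} \<Longrightarrow> (Q has_real_derivative Q' x) (at x within {0..1})"
    and Q': "\<And>x. x \<in> {0..1} \<Longrightarrow> (Q' has_real_derivative Q'' x) (at x within {0..1})"
    and K: "\<And>x. x \<in> {0..1} \<Longrightarrow> \<bar>Q'' x\<bar> \<le> K"
  shows "(trapezoid_estimator Q n x - (F 1 - F 0))\<^sup>2 \<le>
    (K / 2)\<^sup>2 * (\<Sum>i=0..n. (ordered_sample n x (Suc i) - ordered_sample n x i) ^ 5)"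
proof -
  define Y where "Y = ordered_sample n x"
  have mono: "Y i \<le> Y (Suc i)" if "i \<le> n" for i
    unfolding Y_def using that by (intro ordered_sample_mono[OF x]) auto
  have bd: "Y i \<in> {0..1}" if "i \<le> n + 1" for i
    unfolding Y_def using that by (intro ordered_sample_bounds[OF x]) auto
  \<comment> \<open>Needed twice: with \<open>F\<close>, to split the exact integral along the
    spacings, and with the identity, to see that the spacings sum to 1.\<close>
  have tele: "(\<Sum>i=0..n. G (Y (Suc i)) - G (Y i)) = G 1 - G 0" for G :: "real \<Rightarrow> real"
    using sum_Suc_diff[of 0 "Suc n" "\<lambda>i. G (Y i)"]
    by (simp add: atLeast0AtMost lessThan_Suc_atMost[symmetric] sum_lessThan_telescope Y_def)
  have "\<bar>trapezoid_estimator Q n x - (F 1 - F 0)\<bar> =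
     \<bar>\<Sum>i=0..n. 1 / 2 * ((Q (Y i) + Q (Y (Suc i))) * (Y (Suc i) - Y i)) - (F (Y (Suc i)) - F (Y i))\<bar>"
    by (simp only: sum_subtractf[of _ "\<lambda>i. F (Y (Suc i)) - F (Y i)"] tele)
      (simp add: trapezoid_estimator_def Let_def sum_distrib_left Y_def)
  also have "\<dots> \<le> (\<Sum>i=0..n. K / 2 * (Y (Suc i) - Y i) ^ 3)"
    by (intro order.trans[OF sum_abs] sum_mono trapezoid_rule_error[OF _ _ _ F Q Q' K])
      (use bd mono in auto)
  also have "\<dots> = K / 2 * (\<Sum>i=0..n. (Y (Suc i) - Y i) ^ 3)"
    by (simp add: sum_distrib_left)
  finally have "(trapezoid_estimator Q n x - (F 1 - F 0))\<^sup>2 \<le>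
      (K / 2 * (\<Sum>i=0..n. (Y (Suc i) - Y i) ^ 3))\<^sup>2"
    using power_mono[of "\<bar>trapezoid_estimator Q n x - (F 1 - F 0)\<bar>" _ 2] by simp
  also have "\<dots> = (K / 2)\<^sup>2 * (\<Sum>i=0..n. (Y (Suc i) - Y i) ^ 3)\<^sup>2"
    by (rule power_mult_distrib)
  also have "\<dots> \<le> (K / 2)\<^sup>2 * (\<Sum>i=0..n. (Y (Suc i) - Y i) ^ 5)"
    by (intro mult_left_mono sum_cubes_squared_le_sum_fifth_powers)
      (use mono tele[of "\<lambda>y. y"] in auto)
  finally show ?thesis by (simp add: Y_def)
qed

subsection \<open>Spacings as integrals over unseparated pairs\<close>

text \<open>Integrating over \<open>t\<close> gives \<open>5 * (b - s) ^ 4\<close>, and then over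
  \<open>s\<close> gives the fifth power; hence the factor 20 = 5 * 4. The strict
  \<open>t < b\<close> makes the regions of distinct spacings disjoint.\<close>

lemma fifth_power_eq_nn_integral:
  fixes a b :: real
  assumes "a \<le> b"
  shows "ennreal ((b - a) ^ 5) =
    (\<integral>\<^sup>+s. \<integral>\<^sup>+t. ennreal (20 * (t - s) ^ 3) * indicator {(s, t). a \<le> s \<and> s \<le> t \<and> t < b} (s, t)
       \<partial>lborel \<partial>lborel)"
proof -
  have "(\<integral>\<^sup>+t. ennreal (20 * (t - s) ^ 3) * indicator {(s, t). a \<le> s \<and> s \<le> t \<and> t < b} (s, t) \<partial>lborel)
     = ennreal (5 * (b - s) ^ 4) * indicator {a..b} s" for s
  proof (cases "s \<in> {a..b}")
    case True
    have "(\<integral>\<^sup>+t. ennreal (20 * (t - s) ^ 3) * indicator {(s, t). a \<le> s \<and> s \<le> t \<and> t < b} (s, t) \<partial>lborel)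
      = (\<integral>\<^sup>+t. ennreal (20 * (t - s) ^ 3) * indicator {s..b} t \<partial>lborel)"
      \<comment> \<open>The point \<open>t = b\<close> is null, so the interval may be closed for
        the fundamental theorem of calculus.\<close>
      using True AE_lborel_singleton[of b]
      by (intro nn_integral_cong_AE) (auto simp: indicator_def)
    also have "\<dots> = ennreal (5 * (b - s) ^ 4 - 5 * (s - s) ^ 4)"
      using True
      by (intro nn_integral_FTC_Icc) (auto intro!: derivative_eq_intros simp: eval_nat_numeral)
    finally show ?thesis using True by simp
  next
    case False
    then have "indicator {(s, t). a \<le> s \<and> s \<le> t \<and> t < b} (s, t) = (0 :: ennreal)" for t
      by (auto simp: indicator_def)
    with False show ?thesis by simp
  qed
  then have "(\<integral>\<^sup>+s. \<integral>\<^sup>+t. ennreal (20 * (t - s) ^ 3) * indicator {(s, t). a \<le> s \<and> s \<le> t \<and> t < b} (s, t)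
       \<partial>lborel \<partial>lborel) = (\<integral>\<^sup>+s. ennreal (5 * (b - s) ^ 4) * indicator {a..b} s \<partial>lborel)"
    by simp
  also have "\<dots> = ennreal (- ((b - b) ^ 5) - - ((b - a) ^ 5))"
  proof (rule nn_integral_FTC_Icc)
    show "((\<lambda>s. - ((b - s) ^ 5)) has_real_derivative 5 * (b - s) ^ 4) (at s)" for s
      by (auto intro!: derivative_eq_intros)
  qed (use assms in auto)
  finally show ?thesis by simp
qed

text \<open>At most one index contributes to the sum, because the half-open spacings are disjoint.
  If index \<open>i\<close> does, each observation is some \<open>Y j\<close>, hence either at most
  \<open>Y i \<le> s\<close> or at least \<open>Y (Suc i) > t\<close>, so it misses
  \<open>{s<..t}\<close>.\<close>

lemma sum_indicator_spacings_le:
  assumes x: "\<And>k. k \<in> {1..n} \<Longrightarrow> x k \<in> {0..1}"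
  defines "Y \<equiv> ordered_sample n x"
  shows "(\<Sum>i=0..n. indicator {(s, t). Y i \<le> s \<and> s \<le> t \<and> t < Y (Suc i)} (s, t)) \<le>
    (indicator {(s, t). 0 \<le> s \<and> s \<le> t \<and> t \<le> 1 \<and> (\<forall>k\<in>{1..n}. x k \<notin> {s<..t})} (s, t) :: ennreal)"
proof (cases "\<exists>i\<in>{0..n}. Y i \<le> s \<and> s \<le> t \<and> t < Y (Suc i)")
  case False
  then have "(\<Sum>i=0..n. indicator {(s, t). Y i \<le> s \<and> s \<le> t \<and> t < Y (Suc i)} (s, t)) = (0 :: ennreal)"
    by (intro sum.neutral) (auto simp: indicator_def)
  then show ?thesis by simp
next
  case True
  then obtain i where i: "i \<le> n" "Y i \<le> s" "s \<le> t" "t < Y (Suc i)" by auto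
  have mono: "Y j \<le> Y k" if "j \<le> k" "k \<le> n + 1" for j k
    unfolding Y_def using that by (intro ordered_sample_mono[OF x]) auto
  have other: "indicator {(s, t). Y j \<le> s \<and> s \<le> t \<and> t < Y (Suc j)} (s, t) = (0 :: ennreal)"
    if "j \<in> {0..n} - {i}" for j
  proof -
    have "Suc j \<le> i \<or> Suc i \<le> j" using that by auto
    then show ?thesis
      using mono[of "Suc j" i] mono[of "Suc i" j] i that by (auto simp: indicator_def)
  qed
  have "x k \<notin> {s<..t}" if k: "k \<in> {1..n}" for k
  proof -
    obtain j where j: "j \<in> {1..n}" "Y j = x k"
      using ordered_sample_surj[OF k] unfolding Y_def by metis
    have "j \<le> i \<or> Suc i \<le> j" by auto
    then show ?thesis using mono[of j i] mono[of "Suc i" j] i j by auto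
  qed
  moreover have "0 \<le> s" "t \<le> 1"
    using mono[of 0 i] mono[of "Suc i" "Suc n"] i by (auto simp: Y_def)
  ultimately show ?thesis
    using i other by (simp add: sum.remove[of _ i])
qed

text \<open>The gain is that order statistics disappear from the bound: the right-hand side involves
  only the unsorted observations, to which independence applies.\<close>

lemma sum_fifth_powers_spacings_le:
  assumes x: "\<And>k. k \<in> {1..n} \<Longrightarrow> x k \<in> {0..1}"
  shows "ennreal (\<Sum>i=0..n. (ordered_sample n x (Suc i) - ordered_sample n x i) ^ 5) \<le>
    (\<integral>\<^sup>+s. \<integral>\<^sup>+t. ennreal (20 * (t - s) ^ 3) *
       indicator {(s, t). 0 \<le> s \<and> s \<le> t \<and> t \<le> 1 \<and> (\<forall>k\<in>{1..n}. x k \<notin> {s<..t})} (s, t)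
       \<partial>lborel \<partial>lborel)"
proof -
  define Y where "Y = ordered_sample n x"
  have mono: "Y i \<le> Y (Suc i)" if "i \<in> {0..n}" for i
    unfolding Y_def using that by (intro ordered_sample_mono[OF x]) auto
  have g: "(\<lambda>(s, t). ennreal (20 * (t - s) ^ 3) *
       indicator {(s, t). Y i \<le> s \<and> s \<le> t \<and> t < Y (Suc i)} (s, t))
     \<in> borel_measurable (lborel \<Otimes>\<^sub>M lborel)" for i
  proof -
    have "(\<lambda>p. ennreal (20 * (snd p - fst p) ^ 3) *
        indicator {p. Y i \<le> fst p \<and> fst p \<le> snd p \<and> snd p < Y (Suc i)} p)
      \<in> borel_measurable (lborel \<Otimes>\<^sub>M lborel)"
      by measurable
    then show ?thesis by (simp add: case_prod_unfold indicator_def)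
  qed
  have g1: "(\<lambda>s. \<integral>\<^sup>+t. ennreal (20 * (t - s) ^ 3) *
       indicator {(s, t). Y i \<le> s \<and> s \<le> t \<and> t < Y (Suc i)} (s, t) \<partial>lborel)
     \<in> borel_measurable lborel" for i
    by (rule lborel.borel_measurable_nn_integral[OF g])
  have g2: "(\<lambda>t. ennreal (20 * (t - s) ^ 3) *
       indicator {(s, t). Y i \<le> s \<and> s \<le> t \<and> t < Y (Suc i)} (s, t)) \<in> borel_measurable lborel" for i s
  proof -
    have "(\<lambda>t. ennreal (20 * (t - s) ^ 3) * indicator {t. Y i \<le> s \<and> s \<le> t \<and> t < Y (Suc i)} t)
      \<in> borel_measurable lborel"
      by measurable
    then show ?thesis by (simp add: indicator_def)
  qed
  have "ennreal (\<Sum>i=0..n. (Y (Suc i) - Y i) ^ 5) = (\<Sum>i=0..n. ennreal ((Y (Suc i) - Y i) ^ 5))"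
    using mono by (intro sum_ennreal[symmetric]) auto
  also have "\<dots> = (\<Sum>i=0..n. \<integral>\<^sup>+s. \<integral>\<^sup>+t. ennreal (20 * (t - s) ^ 3) *
       indicator {(s, t). Y i \<le> s \<and> s \<le> t \<and> t < Y (Suc i)} (s, t) \<partial>lborel \<partial>lborel)"
    by (intro sum.cong refl fifth_power_eq_nn_integral mono)
  also have "\<dots> = (\<integral>\<^sup>+s. (\<Sum>i=0..n. \<integral>\<^sup>+t. ennreal (20 * (t - s) ^ 3) *
       indicator {(s, t). Y i \<le> s \<and> s \<le> t \<and> t < Y (Suc i)} (s, t) \<partial>lborel) \<partial>lborel)"
    by (rule nn_integral_sum[symmetric, OF g1])
  also have "\<dots> = (\<integral>\<^sup>+s. \<integral>\<^sup>+t. (\<Sum>i=0..n. ennreal (20 * (t - s) ^ 3) *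
       indicator {(s, t). Y i \<le> s \<and> s \<le> t \<and> t < Y (Suc i)} (s, t)) \<partial>lborel \<partial>lborel)"
    by (intro nn_integral_cong nn_integral_sum[symmetric] g2)
  also have "\<dots> \<le> (\<integral>\<^sup>+s. \<integral>\<^sup>+t. ennreal (20 * (t - s) ^ 3) *
       indicator {(s, t). 0 \<le> s \<and> s \<le> t \<and> t \<le> 1 \<and> (\<forall>k\<in>{1..n}. x k \<notin> {s<..t})} (s, t)
       \<partial>lborel \<partial>lborel)"
    unfolding sum_distrib_left[symmetric] Y_def
    by (intro nn_integral_mono mult_left_mono sum_indicator_spacings_le x) auto
  finally show ?thesis by (simp add: Y_def)
qed

subsection \<open>Expectation over a uniform sample\<close>

text \<open>Each observation misses \<open>{s<..t}\<close> with probability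
  \<open>1 - (t - s)\<close>, and independence multiplies these \<open>n\<close> equal
  factors.\<close>

lemma uniform_sample_prob_unseparated:
  assumes U: "uniform_sample M n X" and n: "n \<ge> 1" and st: "0 \<le> s" "s \<le> t" "t \<le> 1"
  shows "emeasure M {\<omega> \<in> space M. \<forall>k\<in>{1..n}. X k \<omega> \<notin> {s<..t}} = ennreal ((1 - (t - s)) ^ n)"
proof -
  interpret prob_space M using U by (simp add: uniform_sample_def)
  have ind: "indep_vars (\<lambda>_. borel) X {1..n}"
    and di: "\<And>i. i \<in> {1..n} \<Longrightarrow> distr M lborel (X i) = uniform_measure lborel {0..1}"
    using U by (auto simp: uniform_sample_def)
  have meas: "X i \<in> borel_measurable M" if "i \<in> {1..n}" for i
    using ind that by (simp add: indep_vars_def)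
  have one: "prob (X i -` (- {s<..t}) \<inter> space M) = 1 - (t - s)" if i: "i \<in> {1..n}" for i
  proof -
    have "emeasure M (X i -` {s<..t} \<inter> space M) = emeasure (distr M lborel (X i)) {s<..t}"
      using meas[OF i] by (subst emeasure_distr) auto
    also have "\<dots> = emeasure lborel ({0..1} \<inter> {s<..t}) / emeasure lborel {0..1::real}"
      unfolding di[OF i] by (rule emeasure_uniform_measure) auto
    also have "{0..1} \<inter> {s<..t} = {s<..t}" using st by auto
    finally have "prob (X i -` {s<..t} \<inter> space M) = t - s"
      using st by (simp add: measure_def divide_ennreal del: ennreal_1 flip: ennreal_1)
    moreover have "X i -` (- {s<..t}) \<inter> space M = space M - (X i -` {s<..t} \<inter> space M)" by auto
    moreover have "X i -` {s<..t} \<inter> space M \<in> events"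
      using meas[OF i] by (rule measurable_sets) auto
    ultimately show ?thesis by (simp add: prob_compl)
  qed
  \<comment> \<open>With an empty index set the intersection would be the whole type instead of
    \<open>space M\<close>; \<open>n \<ge> 1\<close> excludes this.\<close>
  have "{\<omega> \<in> space M. \<forall>k\<in>{1..n}. X k \<omega> \<notin> {s<..t}} = (\<Inter>i\<in>{1..n}. X i -` (- {s<..t}) \<inter> space M)"
    using n by auto
  also have "prob \<dots> = (\<Prod>i\<in>{1..n}. prob (X i -` (- {s<..t}) \<inter> space M))"
    using n by (intro indep_varsD[OF ind]) auto
  also have "\<dots> = (1 - (t - s)) ^ n" using one by simp
  finally show ?thesis by (simp add: emeasure_eq_measure)
qed

lemma gamma_integral_bound:
  fixes s c :: real
  assumes "s \<in> {0..1}" "0 < c"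
  shows "(\<integral>\<^sup>+t. ennreal (20 * (t - s) ^ 3 * exp (- c * (t - s))) * indicator {s..1} t \<partial>lborel)
    \<le> ennreal (120 / c ^ 4)"
proof -
  define G where "G t = - (exp (- c * (t - s)) *
    (20 * (t - s) ^ 3 / c + 60 * (t - s)\<^sup>2 / c ^ 2 + 120 * (t - s) / c ^ 3 + 120 / c ^ 4))" for t
  have "(G has_real_derivative 20 * (t - s) ^ 3 * exp (- c * (t - s))) (at t)" for t
    unfolding G_def using assms
    by (auto intro!: derivative_eq_intros) (simp add: field_simps eval_nat_numeral)
  then have "(\<integral>\<^sup>+t. ennreal (20 * (t - s) ^ 3 * exp (- c * (t - s))) * indicator {s..1} t \<partial>lborel)
      = ennreal (G 1 - G s)"
    using assms by (intro nn_integral_FTC_Icc) auto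
  moreover have "G 1 - G s \<le> 120 / c ^ 4"
    using assms by (simp add: G_def)
  ultimately show ?thesis by (simp add: ennreal_leI)
qed

text \<open>Tonelli's theorem moves the expectation innermost, where for fixed \<open>s\<close> and
  \<open>t\<close> it is the weight times the probability of no separation. The integral over
  \<open>t\<close> is then at most \<open>120 / real n ^ 4\<close>, and \<open>s\<close> runs over
  an interval of length 1.\<close>

lemma expectation_sum_fifth_powers_le:
  assumes U: "uniform_sample M n X" and n: "n \<ge> 1"
  shows "(\<integral>\<^sup>+\<omega>. ennreal (\<Sum>i=0..n. (ordered_sample n (\<lambda>k. X k \<omega>) (Suc i) -
      ordered_sample n (\<lambda>k. X k \<omega>) i) ^ 5) \<partial>M) \<le> ennreal (120 / real n ^ 4)"
proof -
  interpret prob_space M using U by (simp add: uniform_sample_def)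
  interpret LM: pair_sigma_finite M "lborel :: real measure" ..
  have meas [measurable]: "X i \<in> borel_measurable M" if "i \<in> {1..n}" for i
    using U that by (simp add: uniform_sample_def indep_vars_def)
  define A where "A \<omega> s t \<longleftrightarrow> 0 \<le> s \<and> s \<le> t \<and> t \<le> 1 \<and> (\<forall>k\<in>{1..n}. X k \<omega> \<notin> {s<..t})" for \<omega> s t
  define f where "f \<omega> s t = ennreal (20 * (t - s) ^ 3) * indicator {(s, t). A \<omega> s t} (s, t)" for \<omega> s t
  \<comment> \<open>Joint measurability in all three variables supplies what both exchanges need:
    \<open>f1\<close> for swapping with \<open>s\<close>, and \<open>f2\<close> for swapping with
    \<open>t\<close> at fixed \<open>s\<close>.\<close>
  have f_meas: "(\<lambda>((\<omega>, s), t). f \<omega> s t) \<in> borel_measurable ((M \<Otimes>\<^sub>M lborel) \<Otimes>\<^sub>M lborel)"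
  proof -
    have [measurable]: "Measurable.pred ((M \<Otimes>\<^sub>M lborel) \<Otimes>\<^sub>M lborel) (\<lambda>p. A (fst (fst p)) (snd (fst p)) (snd p))"
      unfolding A_def greaterThanAtMost_iff by measurable
    have "(\<lambda>p. ennreal (20 * (snd p - snd (fst p)) ^ 3) *
        indicator {p. A (fst (fst p)) (snd (fst p)) (snd p)} p)
      \<in> borel_measurable ((M \<Otimes>\<^sub>M lborel) \<Otimes>\<^sub>M lborel)"
      by measurable
    then show ?thesis by (simp add: f_def case_prod_unfold indicator_def)
  qed
  have f1: "(\<lambda>(\<omega>, s). \<integral>\<^sup>+t. f \<omega> s t \<partial>lborel) \<in> borel_measurable (M \<Otimes>\<^sub>M lborel)"
    using lborel.borel_measurable_nn_integral[of "\<lambda>p. f (fst p) (snd p)" "M \<Otimes>\<^sub>M lborel"] f_meas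
    by (simp add: case_prod_unfold)
  have f2: "(\<lambda>(\<omega>, t). f \<omega> s t) \<in> borel_measurable (M \<Otimes>\<^sub>M lborel)" for s
  proof -
    have "(\<lambda>p. ((fst p, s), snd p)) \<in> measurable (M \<Otimes>\<^sub>M lborel) ((M \<Otimes>\<^sub>M lborel) \<Otimes>\<^sub>M lborel)"
      by measurable
    from measurable_compose[OF this f_meas] show ?thesis by (simp add: case_prod_unfold)
  qed
  have inner: "(\<integral>\<^sup>+\<omega>. f \<omega> s t \<partial>M) \<le>
    ennreal (20 * (t - s) ^ 3 * exp (- real n * (t - s))) * indicator {s..1} t * indicator {0..1} s" for s t
  proof (cases "0 \<le> s \<and> s \<le> t \<and> t \<le> 1")
    case True
    have "(\<integral>\<^sup>+\<omega>. f \<omega> s t \<partial>M) = (\<integral>\<^sup>+\<omega>. ennreal (20 * (t - s) ^ 3) *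
        indicator {\<omega> \<in> space M. \<forall>k\<in>{1..n}. X k \<omega> \<notin> {s<..t}} \<omega> \<partial>M)"
      using True by (intro nn_integral_cong) (auto simp: f_def A_def indicator_def)
    also have "\<dots> = ennreal (20 * (t - s) ^ 3) *
        emeasure M {\<omega> \<in> space M. \<forall>k\<in>{1..n}. X k \<omega> \<notin> {s<..t}}"
      by (intro nn_integral_cmult_indicator) measurable
    also have "\<dots> = ennreal (20 * (t - s) ^ 3 * (1 - (t - s)) ^ n)"
      using True by (subst uniform_sample_prob_unseparated[OF U n]) (auto simp: ennreal_mult)
    \<comment> \<open>The inequality 1 - u \<le> exp (- u) trades an incomplete Beta integral for a
      Gamma integral with a simple bound.\<close>
    also have "\<dots> \<le> ennreal (20 * (t - s) ^ 3 * exp (- real n * (t - s)))"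
    proof (intro ennreal_leI mult_left_mono)
      have "1 - (t - s) \<le> exp (- (t - s))"
        using exp_ge_add_one_self[of "- (t - s)"] by linarith
      then have "(1 - (t - s)) ^ n \<le> exp (- (t - s)) ^ n"
        using True by (intro power_mono) auto
      then show "(1 - (t - s)) ^ n \<le> exp (- real n * (t - s))"
        by (simp add: exp_of_nat_mult[symmetric] right_diff_distrib)
    qed (use True in auto)
    finally show ?thesis using True by simp
  next
    case False
    then have "f \<omega> s t = 0" for \<omega> by (auto simp: f_def A_def indicator_def)
    then show ?thesis by simp
  qed
  have "(\<integral>\<^sup>+\<omega>. ennreal (\<Sum>i=0..n. (ordered_sample n (\<lambda>k. X k \<omega>) (Suc i) -
      ordered_sample n (\<lambda>k. X k \<omega>) i) ^ 5) \<partial>M) \<le> (\<integral>\<^sup>+\<omega>. \<integral>\<^sup>+s. \<integral>\<^sup>+t. f \<omega> s t \<partial>lborel \<partial>lborel \<partial>M)"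
    unfolding f_def A_def
    by (intro nn_integral_mono sum_fifth_powers_spacings_le)
      (use U in \<open>auto simp: uniform_sample_def\<close>)
  also have "\<dots> = (\<integral>\<^sup>+s. \<integral>\<^sup>+\<omega>. \<integral>\<^sup>+t. f \<omega> s t \<partial>lborel \<partial>M \<partial>lborel)"
    by (rule LM.Fubini'[symmetric, OF f1])
  also have "\<dots> = (\<integral>\<^sup>+s. \<integral>\<^sup>+t. \<integral>\<^sup>+\<omega>. f \<omega> s t \<partial>M \<partial>lborel \<partial>lborel)"
    by (intro nn_integral_cong LM.Fubini'[symmetric, OF f2])
  also have "\<dots> \<le> (\<integral>\<^sup>+s. \<integral>\<^sup>+t. ennreal (20 * (t - s) ^ 3 * exp (- real n * (t - s))) * indicator {s..1} t *
      indicator {0..1} s \<partial>lborel \<partial>lborel)"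
    by (intro nn_integral_mono inner)
  also have "\<dots> \<le> (\<integral>\<^sup>+s. ennreal (120 / real n ^ 4) * indicator {0..1::real} s \<partial>lborel)"
  proof (intro nn_integral_mono)
    fix s :: real
    show "(\<integral>\<^sup>+t. ennreal (20 * (t - s) ^ 3 * exp (- real n * (t - s))) * indicator {s..1} t *
        indicator {0..1} s \<partial>lborel) \<le> ennreal (120 / real n ^ 4) * indicator {0..1} s"
      using gamma_integral_bound[of s "real n"] n by (cases "s \<in> {0..1}") auto
  qed
  also have "\<dots> = ennreal (120 / real n ^ 4)" by (simp add: nn_integral_cmult_indicator)
  finally show ?thesis .
qed

section \<open>The mean square error\<close>

theorem proposition1:
  fixes Q Q' Q'' :: "real \<Rightarrow> real" and \<theta> :: real
  assumes "\<And>x. x \<in> {0..1} \<Longrightarrow> (Q has_real_derivative Q' x) (at x within {0..1})"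
    and "\<And>x. x \<in> {0..1} \<Longrightarrow> (Q' has_real_derivative Q'' x) (at x within {0..1})"
    and "continuous_on {0..1} Q''"
    and "\<theta> = integral {0..1} Q"
  shows "\<exists>C::real. \<forall>n\<ge>1. \<forall>(M :: 'a measure) X. uniform_sample M n X \<longrightarrow>
           integrable M (\<lambda>\<omega>. (trapezoid_estimator Q n (\<lambda>i. X i \<omega>) - \<theta>)\<^sup>2) \<and>
           integral\<^sup>L M (\<lambda>\<omega>. (trapezoid_estimator Q n (\<lambda>i. X i \<omega>) - \<theta>)\<^sup>2) \<le> C / real n ^ 4"
proof -
  have "bounded (Q'' ` {0..1})"
    using assms(3) by (intro compact_imp_bounded compact_continuous_image) auto
  then obtain K where K: "\<And>x. x \<in> {0..1} \<Longrightarrow> \<bar>Q'' x\<bar> \<le> K"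
    unfolding bounded_iff by (metis imageI real_norm_def)
  have Q_cont: "continuous_on {0..1} Q"
    using assms(1) by (intro DERIV_continuous_on)
  define F where "F x = integral {0..x} Q" for x
  have F: "(F has_real_derivative Q x) (at x within {0..1})" if "x \<in> {0..1}" for x
    unfolding F_def by (rule integral_has_real_derivative[OF Q_cont that])
  have \<theta>: "\<theta> = F 1 - F 0" using assms(4) by (simp add: F_def)
  \<comment> \<open>\<open>(K / 2)\<^sup>2\<close> comes from the pathwise bound and 120 from the
    expected sum of fifth powers. Only \<open>Q''\<close> enters, through \<open>K\<close>, so
    \<open>C\<close> is fixed before \<open>n\<close>, \<open>M\<close> and
    \<open>X\<close>.\<close>
  define C where "C = (K / 2)\<^sup>2 * 120"
  have "integrable M (\<lambda>\<omega>. (trapezoid_estimator Q n (\<lambda>i. X i \<omega>) - \<theta>)\<^sup>2) \<and>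
      integral\<^sup>L M (\<lambda>\<omega>. (trapezoid_estimator Q n (\<lambda>i. X i \<omega>) - \<theta>)\<^sup>2) \<le> C / real n ^ 4"
    if n: "n \<ge> 1" and U: "uniform_sample M n X" for n and M :: "'a measure" and X
  proof -
    interpret prob_space M using U by (simp add: uniform_sample_def)
    have X: "X i \<in> borel_measurable M" if "i \<in> {1..n}" for i
      using U that by (simp add: uniform_sample_def indep_vars_def)
    have b: "X i \<omega> \<in> {0..1}" if "i \<in> {1..n}" "\<omega> \<in> space M" for i \<omega>
      using U that by (simp add: uniform_sample_def)
    define D where "D \<omega> = (trapezoid_estimator Q n (\<lambda>i. X i \<omega>) - \<theta>)\<^sup>2" for \<omega>
    define S where "S \<omega> = (\<Sum>i=0..n. (ordered_sample n (\<lambda>k. X k \<omega>) (Suc i) -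
      ordered_sample n (\<lambda>k. X k \<omega>) i) ^ 5)" for \<omega>
    have D_meas: "D \<in> borel_measurable M"
      unfolding D_def
      by (intro borel_measurable_power borel_measurable_diff borel_measurable_const
          trapezoid_estimator_measurable X b Q_cont)
    have S_meas: "S \<in> borel_measurable M"
      unfolding S_def
      by (intro borel_measurable_sum borel_measurable_power borel_measurable_diff
          ordered_sample_measurable X) auto
    have "(\<integral>\<^sup>+\<omega>. ennreal (D \<omega>) \<partial>M) \<le> (\<integral>\<^sup>+\<omega>. ennreal ((K / 2)\<^sup>2) * ennreal (S \<omega>) \<partial>M)"
    proof (intro nn_integral_mono)
      fix \<omega> assume \<omega>: "\<omega> \<in> space M"
      have "D \<omega> \<le> (K / 2)\<^sup>2 * S \<omega>"
        unfolding D_def S_def \<theta>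
        by (rule trapezoid_estimator_error[OF b[OF _ \<omega>] F assms(1,2) K])
      then show "ennreal (D \<omega>) \<le> ennreal ((K / 2)\<^sup>2) * ennreal (S \<omega>)"
        by (simp add: ennreal_mult'[symmetric] ennreal_leI)
    qed
    also have "\<dots> = ennreal ((K / 2)\<^sup>2) * (\<integral>\<^sup>+\<omega>. ennreal (S \<omega>) \<partial>M)"
      using S_meas by (intro nn_integral_cmult) auto
    also have "\<dots> \<le> ennreal ((K / 2)\<^sup>2) * ennreal (120 / real n ^ 4)"
      unfolding S_def by (intro mult_left_mono expectation_sum_fifth_powers_le[OF U n]) auto
    also have "\<dots> = ennreal (C / real n ^ 4)"
      by (simp add: C_def ennreal_mult'[symmetric])
    finally have le: "(\<integral>\<^sup>+\<omega>. ennreal (D \<omega>) \<partial>M) \<le> ennreal (C / real n ^ 4)" .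
    have nonneg: "0 \<le> D \<omega>" for \<omega> by (simp add: D_def)
    \<comment> \<open>Integrability must precede the passage to the Bochner integral, which is 0 by
      default for non-integrable functions.\<close>
    have int: "integrable M D"
      using D_meas nonneg le_less_trans[OF le] by (intro integrableI_nonneg) auto
    have "ennreal (integral\<^sup>L M D) \<le> ennreal (C / real n ^ 4)"
      using le nn_integral_eq_integral[OF int] nonneg by simp
    then have "integral\<^sup>L M D \<le> C / real n ^ 4"
      by (subst (asm) ennreal_le_iff) (auto simp: C_def)
    with int show ?thesis unfolding D_def by blast
  qed
  then show ?thesis by blast
qed

end
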